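(* Let $\mathbb{K}$ be a field and let $I\subseteq S=\mathbb{K}[x,y,z]$ be a Borel ideal (with respect to the ordering $x_1=x$, $x_2=y$, $x_3=z$ of the variables). Let $BG(I)$ be its set of Borel generators. Then the following conditions are equivalent: (a) $I$ satisfies the non-pure dual exchange property. (b) For all $u,v\in BG(I)$ with $\deg(u)\le\deg(v)$, one has $\deg_z(u)\le\deg_z(v)$; moreover, if $\deg_y(u)>\deg_y(v)$, then $\deg_z(u)<\deg_z(v)$.
   Context: Write $x_1=x$, $x_2=y$, $x_3=z$. For a monomial $u=x_1^{a_1}x_2^{a_2}x_3^{a_3}$, $\deg(u)=a_1+a_2+a_3$ and $\deg_{x_i}(u)=a_i$. For a monomial ideal $I$, $G(I)$ is its minimal set of monomial generators. The ideal $I$ satisfies the non-pure dual exchange property if for all $u,v\in G(I)$ with $\deg(u)\le\deg(v)$ and for all $i$ with $\deg_{x_i}(v)<\deg_{x_i}(u)$, there exists $j$ with $\deg_{x_j}(v)>\deg_{x_j}(u)$ such that $x_i(v/x_j)\in I$. A monomial ideal $I$ is a Borel ideal (strongly stable) if it is closed under Borel moves: whenever $u\in I$ is a monomial and $x_j\mid u$, then $\frac{x_i}{x_j}u\in I$ for all $i<j$. For a Borel ideal $I$, the set $BG(I)$ of Borel generators of $I$ is the unique minimal set of monomials whose Borel moves generate $I$, i.e. the unique inclusion-minimal set of monomials such that $I$ is the smallest Borel ideal containing it. *)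

theory Defs
  imports HOL.Modules "HOL-Library.Poly_Mapping"
begin

text \<open>
  A monomial with variables in \<open>'v\<close> is its exponent vector, of type \<open>'v \<Rightarrow>\<^sub>0 nat\<close>; in particular
  the product of monomials is written additively. Polynomials with coefficients in \<open>'k\<close> have
  type \<open>('v \<Rightarrow>\<^sub>0 nat) \<Rightarrow>\<^sub>0 'k\<close>, with the convolution product of polynomial mappings.
\<close>

type_synonym 'v monom = "'v \<Rightarrow>\<^sub>0 nat"
type_synonym ('v, 'k) mpoly = "('v \<Rightarrow>\<^sub>0 nat) \<Rightarrow>\<^sub>0 'k"

abbreviation deg_in :: "'v \<Rightarrow> 'v monom \<Rightarrow> nat" where
  "deg_in i u \<equiv> Poly_Mapping.lookup u i"

definition mdeg :: "'v monom \<Rightarrow> nat" where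
  "mdeg u = (\<Sum>i\<in>Poly_Mapping.keys u. deg_in i u)"

abbreviation mon :: "'v monom \<Rightarrow> ('v, 'k::comm_ring_1) mpoly" where
  "mon u \<equiv> Poly_Mapping.single u 1"

text \<open>
  The monomial \<open>x\<^sub>i (u / x\<^sub>j)\<close>. It is only meaningful if \<open>x\<^sub>j\<close> divides \<open>u\<close>, i.e. \<open>deg_in j u > 0\<close>,
  since subtraction of exponents is truncated; this holds at all uses below.
\<close>
definition exchange :: "'v \<Rightarrow> 'v \<Rightarrow> 'v monom \<Rightarrow> 'v monom" where
  "exchange i j u = Poly_Mapping.single i 1 + (u - Poly_Mapping.single j 1)"

text \<open>
  A commutative ring is a module over itself; its submodules are its ideals
  (\<open>ring_self.subspace\<close>), and \<open>ring_self.span A\<close> is the ideal generated by \<open>A\<close>.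
\<close>
global_interpretation ring_self: module "(*) :: 'a::comm_ring_1 \<Rightarrow> 'a \<Rightarrow> 'a"
  by unfold_locales (simp_all add: algebra_simps)

definition generates :: "'v monom set \<Rightarrow> ('v, 'k::comm_ring_1) mpoly set \<Rightarrow> bool" where
  "generates A I \<longleftrightarrow> I = ring_self.span (mon ` A)"

definition monomial_ideal :: "('v, 'k::comm_ring_1) mpoly set \<Rightarrow> bool" where
  "monomial_ideal I \<longleftrightarrow> (\<exists>A. generates A I)"

text \<open>The set \<open>G(I)\<close>.\<close>
definition min_gens :: "('v, 'k::comm_ring_1) mpoly set \<Rightarrow> 'v monom set" where
  "min_gens I = (THE A. generates A I \<and> (\<forall>A'. A' \<subset> A \<longrightarrow> \<not> generates A' I))"

definition non_pure_dual_exchange :: "('v, 'k::comm_ring_1) mpoly set \<Rightarrow> bool" where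
  "non_pure_dual_exchange I \<longleftrightarrow>
     (\<forall>u\<in>min_gens I. \<forall>v\<in>min_gens I. mdeg u \<le> mdeg v \<longrightarrow>
        (\<forall>i. deg_in i v < deg_in i u \<longrightarrow>
           (\<exists>j. deg_in j v > deg_in j u \<and> mon (exchange i j v) \<in> I)))"

definition borel_ideal :: "('v::linorder, 'k::comm_ring_1) mpoly set \<Rightarrow> bool" where
  "borel_ideal I \<longleftrightarrow> monomial_ideal I \<and>
     (\<forall>u i j. mon u \<in> I \<and> deg_in j u > 0 \<and> i < j \<longrightarrow> mon (exchange i j u) \<in> I)"

text \<open>\<open>I\<close> is the smallest Borel ideal containing \<open>B\<close>.\<close>
definition borel_generates :: "'v::linorder monom set \<Rightarrow> ('v, 'k::comm_ring_1) mpoly set \<Rightarrow> bool" where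
  "borel_generates B I \<longleftrightarrow> borel_ideal I \<and> mon ` B \<subseteq> I \<and>
     (\<forall>J. borel_ideal J \<and> mon ` B \<subseteq> J \<longrightarrow> I \<subseteq> J)"

text \<open>The set \<open>BG(I)\<close>.\<close>
definition borel_gens :: "('v::linorder, 'k::comm_ring_1) mpoly set \<Rightarrow> 'v monom set" where
  "borel_gens I = (THE B. borel_generates B I \<and> (\<forall>B'. B' \<subset> B \<longrightarrow> \<not> borel_generates B' I))"

text \<open>The three variables \<open>x = x\<^sub>1\<close>, \<open>y = x\<^sub>2\<close>, \<open>z = x\<^sub>3\<close>, ordered by their indices.\<close>
datatype xyz = Var_x | Var_y | Var_z

fun xyz_index :: "xyz \<Rightarrow> nat" where
  "xyz_index Var_x = 1"
| "xyz_index Var_y = 2"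
| "xyz_index Var_z = 3"

instantiation xyz :: linorder
begin

definition less_eq_xyz :: "xyz \<Rightarrow> xyz \<Rightarrow> bool" where
  "a \<le> b \<longleftrightarrow> xyz_index a \<le> xyz_index b"

definition less_xyz :: "xyz \<Rightarrow> xyz \<Rightarrow> bool" where
  "a < b \<longleftrightarrow> xyz_index a < xyz_index b"

instance
proof
  fix a b :: xyz
  show "a \<le> b \<Longrightarrow> b \<le> a \<Longrightarrow> a = b"
    by (cases a; cases b) (simp_all add: less_eq_xyz_def)
qed (auto simp: less_eq_xyz_def less_xyz_def)

end

end

(*
  Order the monomials in x, y, z by the triple (deg_x, deg_x + deg_y, deg), componentwise. The
  monomials of a Borel ideal form an up-set for this order, and BG(I) is the set of its minimal
  elements. Each u in G(I) lies above some g in BG(I) of the same degree, and then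
  deg_z u <= deg_z g. For u, v in G(I) with deg u <= deg v, every exchange needed is a Borel move
  of v or lies above u, except z (v/y) when deg_z v < deg_z u. There the Borel generators g, h
  below u, v satisfy deg_z v < deg_z u <= deg_z g <= deg_z h by (b), so z (v/y) still lies above h.
  Conversely, if deg_z v < deg_z u for Borel generators u, v, then an exchange z (v/x_j) in the
  ideal would be strictly below the minimal element v. The clause of (b) on deg_y follows from the
  first one, as distinct Borel generators are incomparable.
*)
theory Submission
  imports Defs
begin

section \<open>Minimal elements of up-sets\<close>

definition up_closure :: "('a \<Rightarrow> 'a \<Rightarrow> bool) \<Rightarrow> 'a set \<Rightarrow> 'a set" where
  "up_closure R A = {w. \<exists>u\<in>A. R u w}"

definition minimals :: "('a \<Rightarrow> 'a \<Rightarrow> bool) \<Rightarrow> 'a set \<Rightarrow> 'a set" where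
  "minimals R U = {u\<in>U. \<forall>w\<in>U. R w u \<longrightarrow> w = u}"

lemma exists_minimal_below:
  fixes rank :: "'a \<Rightarrow> nat"
  assumes refl: "reflp R" and trans: "transp R"
    and rank: "\<forall>a b. R a b \<longrightarrow> a \<noteq> b \<longrightarrow> rank a < rank b"
    and "w \<in> U"
  shows "\<exists>u\<in>minimals R U. R u w"
  using \<open>w \<in> U\<close>
proof (induction "rank w" arbitrary: w rule: less_induct)
  case less
  show ?case
  proof (cases "w \<in> minimals R U")
    case True
    then show ?thesis using refl by (auto dest: reflpD)
  next
    case False
    then obtain w' where "w' \<in> U" "R w' w" "w' \<noteq> w"
      using less.prems by (auto simp: minimals_def)
    moreover from this obtain u where "u \<in> minimals R U" "R u w'"
      using less.hyps[of w'] rank by blast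
    ultimately show ?thesis using transpD[OF trans] by blast
  qed
qed

text \<open>Every generating set contains the minimal elements, and these generate because
  \<open>rank\<close> makes every descent finite. They are thus the least generating set, hence the
  only inclusion-minimal one. Divisibility yields G(I), the Borel order yields BG(I).\<close>

lemma least_generating_set_eq_minimals:
  fixes rank :: "'a \<Rightarrow> nat"
  assumes refl: "reflp R" and trans: "transp R"
    and rank: "\<forall>a b. R a b \<longrightarrow> a \<noteq> b \<longrightarrow> rank a < rank b"
    and up: "up_closure R U = U"
    and gen: "\<And>A. gen A \<longleftrightarrow> up_closure R A = U"
  shows "(THE A. gen A \<and> (\<forall>A'. A' \<subset> A \<longrightarrow> \<not> gen A')) = minimals R U"
proof -
  have sub: "minimals R U \<subseteq> A" if A: "gen A" for A
  proof
    fix u assume u: "u \<in> minimals R U"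
    have eq: "up_closure R A = U" using A gen by simp
    have "u \<in> up_closure R A" using u eq by (simp add: minimals_def)
    then obtain a where a: "a \<in> A" "R a u" by (auto simp: up_closure_def)
    then have "a \<in> U" using eq reflpD[OF refl, of a] by (auto simp: up_closure_def)
    then show "u \<in> A" using a u by (auto simp: minimals_def)
  qed
  have "up_closure R (minimals R U) \<subseteq> up_closure R U"
    by (auto simp: up_closure_def minimals_def)
  moreover have "U \<subseteq> up_closure R (minimals R U)"
  proof
    fix w assume "w \<in> U"
    then have "\<exists>u\<in>minimals R U. R u w"
      by (rule exists_minimal_below[where rank = rank, OF refl trans rank])
    then show "w \<in> up_closure R (minimals R U)" by (simp add: up_closure_def)
  qed
  ultimately have "gen (minimals R U)"
    unfolding gen using up by simp
  then show ?thesis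
  proof (intro the_equality conjI allI impI, goal_cases)
    case (2 A')
    then show ?case using sub[of A'] by blast
  next
    case (3 A)
    then show ?case using sub[of A] by blast
  qed
qed

section \<open>Monomial ideals\<close>

definition monoms :: "('v, 'k::comm_ring_1) mpoly set \<Rightarrow> 'v monom set" where
  "monoms I = {u. mon u \<in> I}"

definition divides :: "'v monom \<Rightarrow> 'v monom \<Rightarrow> bool" where
  "divides u w \<longleftrightarrow> (\<exists>t. w = u + t)"

lemma reflp_divides: "reflp divides"
  unfolding reflp_def divides_def by (metis add.right_neutral)

lemmas divides_refl = reflpD[OF reflp_divides]

lemma transp_divides: "transp divides"
  unfolding transp_def divides_def by (metis add.assoc)

lemmas divides_trans = transpD[OF transp_divides]

lemma subspace_keys_in_up_closure:
  "ring_self.subspace {p :: ('v, 'k::comm_ring_1) mpoly. Poly_Mapping.keys p \<subseteq> up_closure divides A}"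
proof (rule ring_self.subspaceI, goal_cases)
  case 1
  show ?case by simp
next
  case (2 p q)
  then show ?case using Poly_Mapping.keys_add[of p q] by auto
next
  case (3 c p)
  show ?case
  proof safe
    fix w assume "w \<in> Poly_Mapping.keys (c * p)"
    then obtain s t where st: "w = s + t" "t \<in> Poly_Mapping.keys p"
      using keys_mult[of c p] by blast
    then obtain u where "u \<in> A" "divides u t" using 3 by (auto simp: up_closure_def)
    moreover have "divides t w" using st by (auto simp: divides_def add.commute)
    ultimately show "w \<in> up_closure divides A"
      using divides_trans by (auto simp: up_closure_def)
  qed
qed

text \<open>Coefficients are written as constant polynomials, so that each term is a ring multiple
  of \<open>mon w\<close> and closure of an ideal under multiplication applies.\<close>

lemma poly_mapping_eq_sum_mon:
  fixes p :: "('v, 'k::comm_ring_1) mpoly"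
  shows "p = (\<Sum>w\<in>Poly_Mapping.keys p. Poly_Mapping.single 0 (Poly_Mapping.lookup p w) * mon w)"
proof -
  have "(\<Sum>w\<in>Poly_Mapping.keys p. Poly_Mapping.lookup p w when w = k) =
      Poly_Mapping.lookup p k" for k
    by (simp add: when_def in_keys_iff)
  then show ?thesis
    by (intro poly_mapping_eqI) (simp add: mult_single Poly_Mapping.lookup_sum lookup_single)
qed

lemma mon_imp_mem_subspace:
  fixes p :: "('v, 'k::comm_ring_1) mpoly"
  assumes "ring_self.subspace J" "\<And>w. w \<in> Poly_Mapping.keys p \<Longrightarrow> mon w \<in> J"
  shows "p \<in> J"
  by (subst poly_mapping_eq_sum_mon)
    (intro ring_self.subspace_sum ring_self.subspace_scale assms)

lemma mon_in_subspace_divides: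
  fixes J :: "('v, 'k::comm_ring_1) mpoly set"
  assumes "ring_self.subspace J" "mon u \<in> J" "divides u w"
  shows "mon w \<in> J"
proof -
  obtain t where "w = t + u" using assms(3) by (auto simp: divides_def add.commute)
  then have "mon w = mon t * (mon u :: ('v, 'k) mpoly)" by (simp add: mult_single)
  then show ?thesis using ring_self.subspace_scale[OF assms(1,2)] by simp
qed

text \<open>The right-hand side is an ideal containing the generators; conversely, each term of such
  a polynomial is a multiple of a generator. Hence a monomial ideal is determined by its
  monomials.\<close>

lemma span_mon_eq:
  "ring_self.span (mon ` A) =
    {p :: ('v, 'k::comm_ring_1) mpoly. Poly_Mapping.keys p \<subseteq> up_closure divides A}"
    (is "?S = ?T")
proof
  show "?S \<subseteq> ?T"
    by (rule ring_self.span_minimal[OF _ subspace_keys_in_up_closure])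
      (auto simp: up_closure_def intro: divides_refl)
  show "?T \<subseteq> ?S"
  proof
    fix p :: "('v, 'k) mpoly" assume p: "p \<in> ?T"
    show "p \<in> ?S"
    proof (rule mon_imp_mem_subspace)
      fix w assume "w \<in> Poly_Mapping.keys p"
      then obtain u where "u \<in> A" "divides u w" using p by (auto simp: up_closure_def)
      then have "mon u \<in> ?S" by (intro ring_self.span_base imageI)
      then show "mon w \<in> ?S"
        using mon_in_subspace_divides[OF ring_self.subspace_span] \<open>divides u w\<close> by metis
    qed (rule ring_self.subspace_span)
  qed
qed

lemma monoms_span: "monoms (ring_self.span (mon ` A)) = up_closure divides A"
  by (simp add: span_mon_eq monoms_def)

lemma monomial_ideal_subspace: "monomial_ideal I \<Longrightarrow> ring_self.subspace I"
  by (auto simp: monomial_ideal_def generates_def)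

lemma monomial_ideal_eq:
  assumes "monomial_ideal I"
  shows "I = {p. Poly_Mapping.keys p \<subseteq> monoms I}"
  using assms by (metis generates_def monoms_span monomial_ideal_def span_mon_eq)

lemma monomial_ideal_subsetI:
  assumes "monomial_ideal I" "monomial_ideal J" "monoms I \<subseteq> monoms J"
  shows "I \<subseteq> J"
proof -
  have "{p. Poly_Mapping.keys p \<subseteq> monoms I} \<subseteq> {p. Poly_Mapping.keys p \<subseteq> monoms J}"
    using assms(3) by blast
  then show ?thesis
    by (subst monomial_ideal_eq[OF assms(1)], subst monomial_ideal_eq[OF assms(2)])
qed

lemma up_closure_divides_monoms:
  assumes "monomial_ideal I"
  shows "up_closure divides (monoms I) = monoms I"
proof
  show "up_closure divides (monoms I) \<subseteq> monoms I"
    using mon_in_subspace_divides[OF monomial_ideal_subspace[OF assms]]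
    by (auto simp: up_closure_def monoms_def)
  show "monoms I \<subseteq> up_closure divides (monoms I)"
    by (auto simp: up_closure_def intro: divides_refl)
qed

lemma generates_iff:
  assumes "monomial_ideal I"
  shows "generates A I \<longleftrightarrow> up_closure divides A = monoms I"
  unfolding generates_def using assms by (metis monoms_span monomial_ideal_eq span_mon_eq)

section \<open>Monomials in three variables\<close>

lemma UNIV_xyz: "(UNIV :: xyz set) = {Var_x, Var_y, Var_z}"
  using xyz.exhaust by auto

lemma mdeg_xyz: "mdeg u = deg_in Var_x u + deg_in Var_y u + deg_in Var_z u"
proof -
  have "mdeg u = (\<Sum>i\<in>UNIV. deg_in i u)"
    unfolding mdeg_def
    by (rule sum.mono_neutral_left) (simp_all add: in_keys_iff, simp add: UNIV_xyz)
  then show ?thesis by (simp add: UNIV_xyz)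
qed

lemma monom_xyz_eq_iff:
  "u = v \<longleftrightarrow> deg_in Var_x u = deg_in Var_x v \<and> deg_in Var_y u = deg_in Var_y v
     \<and> deg_in Var_z u = deg_in Var_z v"
  (is "_ \<longleftrightarrow> ?R")
proof
  assume ?R
  then have "deg_in k u = deg_in k v" for k by (cases k) auto
  then show "u = v" by (rule poly_mapping_eqI)
qed simp

lemma divides_xyz_iff:
  "divides u v \<longleftrightarrow> deg_in Var_x u \<le> deg_in Var_x v \<and> deg_in Var_y u \<le> deg_in Var_y v
     \<and> deg_in Var_z u \<le> deg_in Var_z v"
  (is "_ \<longleftrightarrow> ?R")
proof
  assume ?R
  then have "v = u + (v - u)" by (simp add: monom_xyz_eq_iff lookup_add lookup_minus)
  then show "divides u v" by (auto simp: divides_def)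
qed (auto simp: divides_def lookup_add)

lemma lookup_exchange:
  "deg_in k (exchange i j u) = (if k = i then 1 else 0) + (deg_in k u - (if k = j then 1 else 0))"
  by (simp add: exchange_def lookup_add lookup_minus lookup_single when_def)

lemma min_gens_eq_minimals:
  fixes I :: "(xyz, 'k::comm_ring_1) mpoly set"
  assumes "monomial_ideal I"
  shows "min_gens I = minimals divides (monoms I)"
  unfolding min_gens_def
proof (rule least_generating_set_eq_minimals[OF reflp_divides transp_divides])
  show "\<forall>a b :: xyz monom. divides a b \<longrightarrow> a \<noteq> b \<longrightarrow> mdeg a < mdeg b"
    by (auto simp: divides_xyz_iff mdeg_xyz monom_xyz_eq_iff)
qed (simp_all add: assms up_closure_divides_monoms generates_iff)

section \<open>The Borel order\<close>

text \<open>The three quantities are the partial sums of the exponent vector. Borel moves shift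
  exponents to earlier variables and multiplication adds exponents, so neither lowers a partial
  sum.\<close>

definition borel_le :: "xyz monom \<Rightarrow> xyz monom \<Rightarrow> bool" where
  "borel_le u v \<longleftrightarrow> deg_in Var_x u \<le> deg_in Var_x v
     \<and> deg_in Var_x u + deg_in Var_y u \<le> deg_in Var_x v + deg_in Var_y v
     \<and> mdeg u \<le> mdeg v"

lemma reflp_borel_le: "reflp borel_le"
  by (simp add: reflp_def borel_le_def)

lemmas borel_le_refl = reflpD[OF reflp_borel_le]

lemma transp_borel_le: "transp borel_le"
  by (auto simp: transp_def borel_le_def)

lemmas borel_le_trans = transpD[OF transp_borel_le]

lemma divides_imp_borel_le: "divides u v \<Longrightarrow> borel_le u v"
  by (auto simp: borel_le_def divides_xyz_iff mdeg_xyz)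

lemma borel_le_exchange: "deg_in j u > 0 \<Longrightarrow> i < j \<Longrightarrow> borel_le u (exchange i j u)"
  by (cases i; cases j) (auto simp: borel_le_def mdeg_xyz lookup_exchange less_xyz_def)

text \<open>The sum of the three coordinates of the Borel order.\<close>
definition borel_rank :: "xyz monom \<Rightarrow> nat" where
  "borel_rank u = 3 * deg_in Var_x u + 2 * deg_in Var_y u + deg_in Var_z u"

lemma borel_rank_less: "borel_le u v \<Longrightarrow> u \<noteq> v \<Longrightarrow> borel_rank u < borel_rank v"
  by (auto simp: borel_le_def borel_rank_def mdeg_xyz monom_xyz_eq_iff)

text \<open>Multiplication by z, the move from z to y and the move from y to x each raise exactly
  one partial sum by one. Correcting first the degree, then x + y, then x leads from
  \<open>u\<close> to \<open>v\<close> without overshooting.\<close>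

lemma monoms_borel_le:
  fixes I :: "(xyz, 'k::comm_ring_1) mpoly set"
  assumes I: "borel_ideal I" and "u \<in> monoms I" "borel_le u v"
  shows "v \<in> monoms I"
  using assms(2,3)
proof (induction "borel_rank v - borel_rank u" arbitrary: u rule: less_induct)
  case less
  let ?x = "deg_in Var_x" and ?y = "deg_in Var_y"
  have step: ?case if "borel_le u u'" "u \<noteq> u'" "borel_le u' v" "u' \<in> monoms I" for u'
    using less.hyps[of u'] that borel_rank_less[OF that(1,2)] borel_rank_less[OF that(3)]
    by (cases "u' = v") auto
  have move: "exchange i j u \<in> monoms I" if "deg_in j u > 0" "i < j" for i j
    using I less.prems(1) that by (auto simp: borel_ideal_def monoms_def)
  consider "mdeg u < mdeg v" | "mdeg u = mdeg v" "?x u + ?y u < ?x v + ?y v"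
    | "mdeg u = mdeg v" "?x u + ?y u = ?x v + ?y v" "?x u < ?x v" | "u = v"
    using less.prems(2) unfolding borel_le_def mdeg_xyz monom_xyz_eq_iff
    by (metis add_left_cancel le_neq_implies_less)
  then show ?case
  proof cases
    case 1
    let ?w = "u + Poly_Mapping.single Var_z 1"
    have "divides u ?w" by (auto simp: divides_def)
    then have "?w \<in> monoms I"
      using up_closure_divides_monoms[of I] I less.prems(1)
      by (auto simp: borel_ideal_def up_closure_def)
    then show ?thesis using 1 less.prems(2)
      by (intro step[of ?w]) (auto simp: borel_le_def mdeg_xyz monom_xyz_eq_iff lookup_add
        lookup_single)
  next
    case 2
    \<comment> \<open>Equal degrees and a smaller sum of x- and y-degrees leave \<open>u\<close>
      with more z than \<open>v\<close>, so there is a z to move.\<close>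
    then have "deg_in Var_z u > 0" by (auto simp: mdeg_xyz)
    then show ?thesis using 2 less.prems(2)
      by (intro step[of "exchange Var_y Var_z u"] move)
        (auto simp: borel_le_def mdeg_xyz monom_xyz_eq_iff lookup_exchange less_xyz_def)
  next
    case 3
    then have "?y u > 0" by auto
    then show ?thesis using 3 less.prems(2)
      by (intro step[of "exchange Var_x Var_y u"] move)
        (auto simp: borel_le_def mdeg_xyz monom_xyz_eq_iff lookup_exchange less_xyz_def)
  next
    case 4
    then show ?thesis using less.prems by simp
  qed
qed

lemma up_closure_borel_le_monoms:
  fixes I :: "(xyz, 'k::comm_ring_1) mpoly set"
  assumes "borel_ideal I"
  shows "up_closure borel_le (monoms I) = monoms I"
  using monoms_borel_le[OF assms] borel_le_refl by (auto simp: up_closure_def)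

text \<open>This ideal is the smallest Borel ideal containing \<open>B\<close>; any ideal
  Borel-generated by \<open>B\<close> is compared with it.\<close>

lemma exists_borel_ideal_monoms_eq:
  "\<exists>J :: (xyz, 'k::comm_ring_1) mpoly set. borel_ideal J \<and> monoms J = up_closure borel_le B"
proof -
  let ?U = "up_closure borel_le B"
  let ?J = "ring_self.span (mon ` ?U) :: (xyz, 'k) mpoly set"
  have up: "w \<in> ?U" if "u \<in> ?U" "borel_le u w" for u w
    using that borel_le_trans by (auto simp: up_closure_def)
  \<comment> \<open>Divisibility is part of the Borel order, so passing to the span adds no new
    monomials.\<close>
  have "up_closure divides ?U \<subseteq> ?U"
    using up divides_imp_borel_le by (auto simp: up_closure_def[of divides])
  moreover have "?U \<subseteq> up_closure divides ?U"
    using divides_refl by (auto simp: up_closure_def[of divides])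
  ultimately have J: "monoms ?J = ?U"
    by (simp add: monoms_span)
  have "mon (exchange i j u) \<in> ?J" if "mon u \<in> ?J" "deg_in j u > 0" "i < j" for u i j
    using up[of u] borel_le_exchange[of u j i] that J by (auto simp: monoms_def)
  then have "borel_ideal ?J"
    unfolding borel_ideal_def monomial_ideal_def generates_def by blast
  with J show ?thesis by blast
qed

lemma borel_generates_iff:
  fixes I :: "(xyz, 'k::comm_ring_1) mpoly set"
  assumes I: "borel_ideal I"
  shows "borel_generates B I \<longleftrightarrow> up_closure borel_le B = monoms I"
proof
  have B: "B \<subseteq> up_closure borel_le B"
    using borel_le_refl by (auto simp: up_closure_def)
  have least: "up_closure borel_le B \<subseteq> monoms J"
    if "borel_ideal J" "mon ` B \<subseteq> J" for J :: "(xyz, 'k) mpoly set"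
    using that monoms_borel_le[OF that(1)] by (fastforce simp: up_closure_def monoms_def)
  {
    assume gen: "borel_generates B I"
    obtain J :: "(xyz, 'k) mpoly set" where J: "borel_ideal J" "monoms J = up_closure borel_le B"
      using exists_borel_ideal_monoms_eq by blast
    then have "mon ` B \<subseteq> J" using B by (auto simp: monoms_def)
    then have "I \<subseteq> J" using gen J by (auto simp: borel_generates_def)
    then have "monoms I \<subseteq> up_closure borel_le B" using J by (auto simp: monoms_def)
    then show "up_closure borel_le B = monoms I"
      using least[OF I] gen by (auto simp: borel_generates_def)
  next
    assume eq: "up_closure borel_le B = monoms I"
    have "I \<subseteq> J" if "borel_ideal J" "mon ` B \<subseteq> J" for J
      using least[OF that] that(1) I eq
      by (intro monomial_ideal_subsetI) (auto simp: borel_ideal_def)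
    then show "borel_generates B I"
      using I B eq by (auto simp: borel_generates_def monoms_def)
  }
qed

lemma borel_gens_eq_minimals:
  fixes I :: "(xyz, 'k::comm_ring_1) mpoly set"
  assumes "borel_ideal I"
  shows "borel_gens I = minimals borel_le (monoms I)"
  unfolding borel_gens_def
  by (rule least_generating_set_eq_minimals[where rank = borel_rank, OF reflp_borel_le transp_borel_le _ up_closure_borel_le_monoms[OF assms] borel_generates_iff[OF assms]])
    (use borel_rank_less in blast)

section \<open>The dual exchange property\<close>

text \<open>A divisor is also smaller in the Borel order, so minimality there implies minimality for
  divisibility.\<close>

lemma borel_gens_subset_min_gens:
  fixes I :: "(xyz, 'k::comm_ring_1) mpoly set"
  assumes "borel_ideal I"
  shows "borel_gens I \<subseteq> min_gens I"
proof -
  have "monomial_ideal I" using assms by (simp add: borel_ideal_def)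
  then show ?thesis
    using divides_imp_borel_le
    by (auto simp: borel_gens_eq_minimals[OF assms] min_gens_eq_minimals minimals_def)
qed

text \<open>
  If \<open>u\<close> had larger degree than the Borel generator below it, then dividing \<open>u\<close> by its last
  variable would not leave the ideal.
\<close>
lemma min_gen_above_borel_gen:
  fixes I :: "(xyz, 'k::comm_ring_1) mpoly set"
  assumes I: "borel_ideal I" and u: "u \<in> min_gens I"
  obtains g where "g \<in> borel_gens I" "borel_le g u" "mdeg g = mdeg u"
proof -
  have "monomial_ideal I" using I by (simp add: borel_ideal_def)
  then have u: "u \<in> minimals divides (monoms I)"
    using u min_gens_eq_minimals by blast
  then have "u \<in> monoms I" by (simp add: minimals_def)
  then obtain g where g: "g \<in> minimals borel_le (monoms I)" "borel_le g u"
    using exists_minimal_below[OF reflp_borel_le transp_borel_le, of borel_rank] borel_rank_less by blast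
  have "\<not> mdeg g < mdeg u"
  proof
    assume less: "mdeg g < mdeg u"
    have no: "\<not> borel_le g (u - Poly_Mapping.single i 1)" if "deg_in i u > 0" for i
    proof
      let ?w = "u - Poly_Mapping.single i 1"
      assume "borel_le g ?w"
      then have "?w \<in> monoms I"
        using monoms_borel_le[OF I] g(1) by (auto simp: minimals_def)
      moreover have "divides ?w u" by (simp add: divides_xyz_iff lookup_minus)
      ultimately have "?w = u" using u by (auto simp: minimals_def)
      then have "deg_in i ?w = deg_in i u" by simp
      then show False using that by (simp add: lookup_minus)
    qed
    \<comment> \<open>The cases single out the last variable dividing \<open>u\<close>. Removing it
      lowers only partial sums equal to the degree of \<open>u\<close>; these exceed the degree of
      \<open>g\<close>, so \<open>g\<close> stays below the quotient.\<close>
    consider "deg_in Var_z u > 0" | "deg_in Var_z u = 0" "deg_in Var_y u > 0"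
      | "deg_in Var_z u = 0" "deg_in Var_y u = 0" "deg_in Var_x u > 0"
      using less by (auto simp: mdeg_xyz)
    then show False
    proof cases
      case 1
      then show ?thesis using no[of Var_z] less g(2)
        by (auto simp: borel_le_def mdeg_xyz lookup_minus lookup_single)
    next
      case 2
      then show ?thesis using no[of Var_y] less g(2)
        by (auto simp: borel_le_def mdeg_xyz lookup_minus lookup_single)
    next
      case 3
      then show ?thesis using no[of Var_x] less g(2)
        by (auto simp: borel_le_def mdeg_xyz lookup_minus lookup_single)
    qed
  qed
  then show ?thesis
    using that g by (auto simp: borel_le_def borel_gens_eq_minimals[OF I])
qed

section \<open>From condition (b) to the exchange property\<close>

lemma exchange_of_deg_z_mono:
  fixes I :: "(xyz, 'k::comm_ring_1) mpoly set"
  assumes I: "borel_ideal I"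
    and mono: "\<And>g h. g \<in> borel_gens I \<Longrightarrow> h \<in> borel_gens I \<Longrightarrow> mdeg g \<le> mdeg h
      \<Longrightarrow> deg_in Var_z g \<le> deg_in Var_z h"
    and u: "u \<in> min_gens I" and v: "v \<in> min_gens I" and deg: "mdeg u \<le> mdeg v"
    and i: "deg_in i v < deg_in i u"
  shows "\<exists>j. deg_in j v > deg_in j u \<and> mon (exchange i j v) \<in> I"
proof -
  obtain g where g: "g \<in> borel_gens I" "borel_le g u" "mdeg g = mdeg u"
    using min_gen_above_borel_gen[OF I u] .
  obtain h where h: "h \<in> borel_gens I" "borel_le h v" "mdeg h = mdeg v"
    using min_gen_above_borel_gen[OF I v] .
  have gh: "deg_in Var_z g \<le> deg_in Var_z h" using mono g h deg by simp
  have mem: "u \<in> monoms I" "v \<in> monoms I" "h \<in> monoms I"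
    using u v h I
    by (auto simp: borel_gens_eq_minimals[OF I] min_gens_eq_minimals borel_ideal_def minimals_def)
  have above: "mon w \<in> I" if "borel_le t w" "t \<in> monoms I" for t w
    using monoms_borel_le[OF I] that by (auto simp: monoms_def)
  note defs = borel_le_def mdeg_xyz lookup_exchange
  \<comment> \<open>Exchanging a later variable for an earlier one is a Borel move, so it stays in
    the ideal.\<close>
  have move: ?thesis if "deg_in j v > deg_in j u" "i < j" for j
    using above[OF borel_le_exchange[of v j i] mem(2)] that by auto
  show ?thesis
  proof (cases i)
    case Var_x
    then have "deg_in Var_y v > deg_in Var_y u \<or> deg_in Var_z v > deg_in Var_z u"
      using i deg by (auto simp: mdeg_xyz)
    then show ?thesis using move Var_x by (auto simp: less_xyz_def)
  next
    case Var_y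
    show ?thesis
    proof (cases "deg_in Var_z v > deg_in Var_z u")
      case True
      then show ?thesis using move Var_y by (auto simp: less_xyz_def)
    next
      case False
      then have x: "deg_in Var_x v > deg_in Var_x u"
        using i deg Var_y by (auto simp: mdeg_xyz)
      \<comment> \<open>The x-degree of \<open>v\<close> has a unit to spare over that of
        \<open>u\<close>. The sum of x- and y-degrees is unchanged and at least that of
        \<open>u\<close>, since \<open>v\<close> has no more z and no smaller degree.\<close>
      have "borel_le u (exchange i Var_x v)"
        using False x i deg Var_y by (auto simp: defs)
      then show ?thesis using above mem(1) x by blast
    qed
  next
    case Var_z
    show ?thesis
    proof (cases "deg_in Var_x v > deg_in Var_x u")
      case True
      then have "borel_le u (exchange i Var_x v)"
        using i deg Var_z by (auto simp: defs)
      then show ?thesis using above mem(1) True by blast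
    next
      case False
      then have y: "deg_in Var_y v > deg_in Var_y u"
        using i deg Var_z by (auto simp: mdeg_xyz)
      \<comment> \<open>The exchanged monomial need not lie above \<open>u\<close>, whose x-degree
        may be larger than that of \<open>v\<close>, so it is compared with \<open>h\<close>. As
        \<open>h\<close> and \<open>v\<close> have equal degree, this inequality gives
        \<open>v\<close> the spare unit of x + y that the exchange from y to z costs.\<close>
      have "deg_in Var_z v < deg_in Var_z h"
        using i Var_z g gh by (auto simp: defs)
      then have "borel_le h (exchange i Var_y v)"
        using y h Var_z by (auto simp: defs)
      then show ?thesis using above mem(3) y by blast
    qed
  qed
qed

section \<open>From the exchange property to condition (b)\<close>

lemma deg_z_mono_of_exchange:
  fixes I :: "(xyz, 'k::comm_ring_1) mpoly set"
  assumes I: "borel_ideal I" and ex: "non_pure_dual_exchange I"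
    and u: "u \<in> borel_gens I" and v: "v \<in> borel_gens I" and deg: "mdeg u \<le> mdeg v"
  shows "deg_in Var_z u \<le> deg_in Var_z v"
proof (rule ccontr)
  assume z: "\<not> ?thesis"
  moreover have "u \<in> min_gens I" "v \<in> min_gens I"
    using u v borel_gens_subset_min_gens[OF I] by auto
  ultimately obtain j where j: "deg_in j v > deg_in j u" "exchange Var_z j v \<in> monoms I"
    using ex deg unfolding non_pure_dual_exchange_def monoms_def not_le mem_Collect_eq by blast
  \<comment> \<open>Since \<open>v\<close> has less z than \<open>u\<close>, \<open>j\<close> is x
    or y; replacing it by z lowers a partial sum and raises none.\<close>
  then have less: "borel_le (exchange Var_z j v) v" "exchange Var_z j v \<noteq> v"
    using z by (cases j; auto simp: borel_le_def mdeg_xyz monom_xyz_eq_iff lookup_exchange)+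
  then show False
    using j v by (auto simp: borel_gens_eq_minimals[OF I] minimals_def)
qed

text \<open>If the z-degrees were equal, the larger y-degree and the smaller total degree of
  \<open>u\<close> would force a smaller x-degree. Then \<open>u\<close> would lie below
  \<open>v\<close> in the Borel order, and minimality would make them equal.\<close>

lemma deg_z_strict_mono:
  fixes I :: "(xyz, 'k::comm_ring_1) mpoly set"
  assumes I: "borel_ideal I" and u: "u \<in> borel_gens I" and v: "v \<in> borel_gens I"
    and deg: "mdeg u \<le> mdeg v" and z: "deg_in Var_z u \<le> deg_in Var_z v"
    and y: "deg_in Var_y u > deg_in Var_y v"
  shows "deg_in Var_z u < deg_in Var_z v"
proof (rule ccontr)
  assume "\<not> ?thesis"
  then have "borel_le u v \<or> borel_le v u"
    using deg z y by (auto simp: borel_le_def mdeg_xyz)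
  then have "u = v"
    using u v by (auto simp: borel_gens_eq_minimals[OF I] minimals_def)
  then show False using y by simp
qed

theorem theorem3p7:
  fixes I :: "(xyz, 'k::field) mpoly set"
  assumes "borel_ideal I"
  shows "non_pure_dual_exchange I \<longleftrightarrow>
    (\<forall>u\<in>borel_gens I. \<forall>v\<in>borel_gens I. mdeg u \<le> mdeg v \<longrightarrow>
       deg_in Var_z u \<le> deg_in Var_z v \<and>
       (deg_in Var_y u > deg_in Var_y v \<longrightarrow> deg_in Var_z u < deg_in Var_z v))"
    (is "_ \<longleftrightarrow> ?R")
proof
  assume "non_pure_dual_exchange I"
  then show ?R
    using deg_z_mono_of_exchange[OF assms] deg_z_strict_mono[OF assms] by blast
next
  assume ?R
  then show "non_pure_dual_exchange I"
    unfolding non_pure_dual_exchange_def using exchange_of_deg_z_mono[OF assms] by blast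
qed

end
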